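(* For every integer $d\ge 2$ there exist a graph $H_d$ with $n=2^d$ vertices and $\frac12 n\log_2 n$ edges, and an embedding $\mathbf{p}$ of the vertices of $H_d$ in $\mathbb{R}^2$, such that no three vertices of $H_d$ are embedded to a common line in $\mathbb{R}^2$, and for every subset $S$ of the vertices with $|S|\ge 3$, the framework $(H_d[S],\mathbf{p}|_S)$ (induced subgraph with the restricted embedding) is not rigid.
   Context: A framework is a pair $(G,\mathbf{p})$ of a graph $G$ on vertex set $V$ and an embedding $\mathbf{p}:V\to\mathbb{R}^2$. Two frameworks $(G,\mathbf{p})$, $(G,\mathbf{q})$ are equivalent if $\|\mathbf{p}(i)-\mathbf{p}(j)\|=\|\mathbf{q}(i)-\mathbf{q}(j)\|$ for every edge $\{i,j\}$ of $G$, and congruent if this equality holds for every pair $i,j\in V$. The framework $(G,\mathbf{p})$ is rigid if there is a neighborhood $B$ of $\mathbf{p}$ in $(\mathbb{R}^2)^V$ such that every framework $(G,\mathbf{p}')$ equivalent to $(G,\mathbf{p})$ with $\mathbf{p}'\in B$ is congruent to $(G,\mathbf{p})$. *)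

theory Defs
  imports "HOL-Analysis.Analysis"
begin

definition simple_graph :: "'a set \<Rightarrow> 'a set set \<Rightarrow> bool" where
  "simple_graph V E \<longleftrightarrow> finite V \<and> (\<forall>e\<in>E. e \<subseteq> V \<and> card e = 2)"

definition induced_edges :: "'a set set \<Rightarrow> 'a set \<Rightarrow> 'a set set" where
  "induced_edges E S = {e \<in> E. e \<subseteq> S}"

definition equivalent_frameworks :: "'a set set \<Rightarrow> ('a \<Rightarrow> real^2) \<Rightarrow> ('a \<Rightarrow> real^2) \<Rightarrow> bool" where
  "equivalent_frameworks E p q \<longleftrightarrow>
     (\<forall>i j. {i, j} \<in> E \<longrightarrow> norm (p i - p j) = norm (q i - q j))"

definition congruent_frameworks :: "'a set \<Rightarrow> ('a \<Rightarrow> real^2) \<Rightarrow> ('a \<Rightarrow> real^2) \<Rightarrow> bool" where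
  "congruent_frameworks V p q \<longleftrightarrow>
     (\<forall>i\<in>V. \<forall>j\<in>V. norm (p i - p j) = norm (q i - q j))"

(* The space (R^2)^V is the product topology indexed by V, whose points are the functions that
   are undefined outside V; hence p enters as restrict p V, and its values outside V play no role.
   The nearby placements p' are arbitrary maps: if p is injective on a finite V, all p'
   sufficiently close to p are injective as well. *)
definition rigid_framework :: "'a set \<Rightarrow> 'a set set \<Rightarrow> ('a \<Rightarrow> real^2) \<Rightarrow> bool" where
  "rigid_framework V E p \<longleftrightarrow>
     (\<exists>B. openin (product_topology (\<lambda>_. euclidean) V) B \<and> restrict p V \<in> B \<and>
          (\<forall>p'\<in>B. equivalent_frameworks E p p' \<longrightarrow> congruent_frameworks V p p'))"

end

(* The d-dimensional cube graph is drawn as a projection of the cube: the vertex A \<subseteq> {..<d} is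
   placed at the sum of v i over i in A. Rotating a single v k keeps the length of every edge. Three
   vertices of the bipartite cube graph are never pairwise adjacent, so S contains two vertices at
   Hamming distance at least 2; if k is one of the coordinates in which they differ, their distance
   is not preserved by the rotation, provided the v i are generic enough that no three vertices of
   the cube become collinear. *)
theory Submission
  imports Defs "HOL-Library.Nat_Bijection"
begin

section \<open>Signed digit expansions of zero\<close>

text \<open>Among the nonzero digits take the one with the smallest exponent. Every other term is
  divisible by the next power of \<open>K\<close>, hence so is this one, and \<open>K\<close>
  divides a nonzero digit smaller than \<open>K\<close> in absolute value.\<close>

lemma sum_power_eq_0_imp_digits_eq_0:
  fixes c :: "'a \<Rightarrow> int" and e :: "'a \<Rightarrow> nat" and K :: int
  assumes "finite I" "inj_on e I" "\<And>i. i \<in> I \<Longrightarrow> \<bar>c i\<bar> < K"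
    and sum0: "(\<Sum>i\<in>I. c i * K ^ e i) = 0" and "i \<in> I"
  shows "c i = 0"
proof (rule ccontr)
  assume "c i \<noteq> 0"
  define J where "J = {i\<in>I. c i \<noteq> 0}"
  have "i \<in> J" using \<open>c i \<noteq> 0\<close> \<open>i \<in> I\<close> by (simp add: J_def)
  then obtain m where m: "m \<in> J" "\<And>j. j \<in> J \<Longrightarrow> e m \<le> e j"
    using ex_has_least_nat[of "\<lambda>i. i \<in> J" i e] by blast
  have "finite J" using \<open>finite I\<close> by (simp add: J_def)
  have "(\<Sum>i\<in>J. c i * K ^ e i) = 0"
    using sum0 sum.mono_neutral_left[of I J "\<lambda>i. c i * K ^ e i"] \<open>finite I\<close>
    by (auto simp: J_def)
  then have eq: "c m * K ^ e m = - (\<Sum>i\<in>J - {m}. c i * K ^ e i)"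
    using sum.remove[OF \<open>finite J\<close> m(1), of "\<lambda>i. c i * K ^ e i"] by simp
  have "K ^ Suc (e m) dvd c j * K ^ e j" if "j \<in> J - {m}" for j
  proof -
    have "e m \<noteq> e j" using that m(1) \<open>inj_on e I\<close> by (auto simp: J_def inj_on_def)
    then have "Suc (e m) \<le> e j" using m(2)[of j] that by simp
    then show ?thesis by (intro dvd_mult le_imp_power_dvd)
  qed
  then have "K ^ Suc (e m) dvd c m * K ^ e m"
    unfolding eq dvd_minus_iff by (rule dvd_sum)
  moreover have "\<bar>c m\<bar> < K" "c m \<noteq> 0" using m(1) assms(3) by (auto simp: J_def)
  ultimately have "K dvd c m" by auto
  then show False using \<open>\<bar>c m\<bar> < K\<close> \<open>c m \<noteq> 0\<close>
    by (meson dvd_imp_le_int not_less abs_ge_self order_trans)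
qed

section \<open>Cross products and rotations in the plane\<close>

definition cross :: "real^2 \<Rightarrow> real^2 \<Rightarrow> real" where
  "cross u w = u$1 * w$2 - u$2 * w$1"

lemma collinear_3_imp_cross_eq_0:
  assumes "collinear {a, b, c}"
  shows "cross (b - a) (c - a) = 0"
proof -
  have "collinear {0, b - a, c - a}"
    using assms collinear_3[of b a c] by (simp add: insert_commute)
  then consider "b - a = 0" | "c - a = 0" | r where "c - a = r *\<^sub>R (b - a)"
    by (auto simp only: collinear_lemma)
  then show ?thesis by cases (simp_all only: cross_def, auto)
qed

definition rot :: "real \<Rightarrow> real^2 \<Rightarrow> real^2" where
  "rot t v = vector [cos t * v$1 - sin t * v$2, sin t * v$1 + cos t * v$2]"

lemma rot_0 [simp]: "rot 0 v = v"
  by (simp add: rot_def vec_eq_iff forall_2)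

lemma norm_rot [simp]: "norm (rot t v) = norm v"
proof -
  have "(rot t v) \<bullet> (rot t v) = (cos t ^ 2 + sin t ^ 2) * (v \<bullet> v)"
    unfolding rot_def inner_vec_def sum_2 inner_real_def vector_2 by algebra
  then show ?thesis by (simp add: norm_eq)
qed

lemma continuous_on_rot: "continuous_on UNIV (\<lambda>t. rot t v)"
proof -
  have "rot t v = cos t *\<^sub>R v + sin t *\<^sub>R vector [- v$2, v$1]" for t
    by (simp add: rot_def vec_eq_iff forall_2)
  then show ?thesis by (simp add: continuous_intros)
qed

text \<open>After squaring, each norm condition says that the rotation does not change the inner
  product with \<open>w\<close>. One angle would not suffice, since the rotated vector may be the
  mirror image of \<open>v\<close> in the line of \<open>w\<close>; subtracting the conditions for
  \<open>t\<close> and \<open>- t\<close> cancels the cosine terms and leaves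
  \<open>2 * sin t * cross v w\<close>.\<close>

lemma norm_rot_add_const_imp_cross_eq_0:
  assumes "sin t \<noteq> 0"
    and "norm (rot t v + w) = norm (v + w)" "norm (rot (- t) v + w) = norm (v + w)"
  shows "cross v w = 0"
proof -
  have *: "rot s v \<bullet> w = v \<bullet> w" if "norm (rot s v + w) = norm (v + w)" for s
  proof -
    have "rot s v \<bullet> rot s v = v \<bullet> v" by (simp flip: norm_eq)
    then show ?thesis
      using that by (simp add: norm_eq inner_add_left inner_add_right inner_commute)
  qed
  have "rot t v \<bullet> w - rot (- t) v \<bullet> w = 2 * sin t * cross v w"
    unfolding rot_def cross_def inner_vec_def sum_2 inner_real_def vector_2 cos_minus sin_minus
    by algebra
  then show ?thesis using assms by (simp add: *)
qed

section \<open>The cube graph on binary codes of sets\<close>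

definition cube_vertices :: "nat \<Rightarrow> nat set" where
  "cube_vertices d = set_encode ` Pow {..<d}"

text \<open>Each edge arises from exactly one pair: its direction \<open>i\<close> and its lower
  endpoint \<open>A\<close>. Counting edges thus becomes counting pairs.\<close>

definition cube_edges :: "nat \<Rightarrow> nat set set" where
  "cube_edges d = (\<lambda>(i, A). {set_encode A, set_encode (insert i A)}) `
     (SIGMA i:{..<d}. Pow ({..<d} - {i}))"

text \<open>The axis vectors are a parameter, so that the placement with one rotated axis is again
  of this form.\<close>

definition cube_proj :: "(nat \<Rightarrow> 'v::comm_monoid_add) \<Rightarrow> nat \<Rightarrow> 'v" where
  "cube_proj v x = sum v (set_decode x)"

lemma mem_cube_vertices: "x \<in> cube_vertices d \<longleftrightarrow> set_decode x \<subseteq> {..<d}"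
  unfolding cube_vertices_def
  by (metis (no_types, lifting) PowD PowI finite_lessThan finite_subset image_iff
      set_decode_inverse set_encode_inverse)

lemma finite_subset_lessThan: "A \<subseteq> {..<d::nat} \<Longrightarrow> finite A"
  by (rule finite_subset) auto

lemma card_cube_vertices: "card (cube_vertices d) = 2 ^ d"
proof -
  have "inj_on set_encode (Pow {..<d})"
    by (rule inj_on_subset[OF inj_on_set_encode]) (auto intro: finite_subset_lessThan)
  then show ?thesis by (simp add: cube_vertices_def card_image card_Pow)
qed

lemma simple_graph_cube: "simple_graph (cube_vertices d) (cube_edges d)"
proof -
  have "e \<subseteq> cube_vertices d \<and> card e = 2" if edge: "e \<in> cube_edges d" for e
  proof -
    obtain i A where i: "i < d" "A \<subseteq> {..<d} - {i}"
      and e: "e = {set_encode A, set_encode (insert i A)}"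
      using edge by (auto simp: cube_edges_def)
    have "finite A" using i(2) by (auto intro: finite_subset_lessThan)
    then have "set_encode A \<noteq> set_encode (insert i A)"
      using i(2) set_encode_eq[of A "insert i A"] by blast
    then show ?thesis using i by (auto simp: e cube_vertices_def)
  qed
  then show ?thesis by (simp add: simple_graph_def cube_vertices_def)
qed

lemma card_cube_edges: "card (cube_edges d) = d * 2 ^ (d - 1)"
proof -
  let ?I = "SIGMA i:{..<d}. Pow ({..<d} - {i})"
  have "inj_on (\<lambda>(i, A). {set_encode A, set_encode (insert i A)}) ?I"
  proof (rule inj_onI, clarify)
    fix i j A B
    assume A: "i < d" "A \<subseteq> {..<d} - {i}" and B: "j < d" "B \<subseteq> {..<d} - {j}"
      and eq: "{set_encode A, set_encode (insert i A)} = {set_encode B, set_encode (insert j B)}"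
    have "finite A" "finite B" using A B by (auto intro: finite_subset_lessThan)
    then have "A = B \<and> insert i A = insert j B \<or> A = insert j B \<and> insert i A = B"
      using eq by (simp add: doubleton_eq_iff set_encode_eq)
    \<comment> \<open>The crossed matching of endpoints is impossible: it would make each of
      \<open>A\<close> and \<open>B\<close> a proper subset of the other.\<close>
    then show "i = j \<and> A = B" using A B by blast
  qed
  moreover have "card ({..<d} - {i}) = d - 1" if "i < d" for i using that by simp
  ultimately show ?thesis
    by (simp add: cube_edges_def card_image card_SigmaI card_Pow)
qed

section \<open>General position of the projected cube\<close>

text \<open>No line contains three vertices of a cube: the hypothesis says that all 2 by 2 minors of
  the difference vectors \<open>B - A\<close> and \<open>C - A\<close> vanish. At a coordinate
  \<open>i\<close> where \<open>B\<close> differs from \<open>A\<close>, the second vector has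
  either entry 0, which forces \<open>C = A\<close>, or the same entry as the first, which forces
  \<open>C = B\<close>.\<close>

lemma indicator_differences_dependent:
  fixes A B C :: "'a set"
  assumes "\<And>i j. i \<in> D \<Longrightarrow> j \<in> D \<Longrightarrow>
     (of_bool (i \<in> B) - of_bool (i \<in> A) :: int) * (of_bool (j \<in> C) - of_bool (j \<in> A))
     - (of_bool (i \<in> C) - of_bool (i \<in> A)) * (of_bool (j \<in> B) - of_bool (j \<in> A)) = 0"
    and "A \<subseteq> D" "B \<subseteq> D" "C \<subseteq> D"
  shows "A = B \<or> A = C \<or> B = C"
proof (rule ccontr)
  assume neq: "\<not> ?thesis"
  then obtain i where i: "i \<in> D" "i \<in> B \<longleftrightarrow> i \<notin> A" using assms(2,3) by blast
  show False
  proof (cases "i \<in> C \<longleftrightarrow> i \<in> A")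
    case True
    then have "j \<in> C \<longleftrightarrow> j \<in> A" if "j \<in> D" for j
      using assms(1)[OF i(1) that] i(2) by (cases "i \<in> A") (auto simp: of_bool_def split: if_splits)
    then show False using neq assms(2,4) by blast
  next
    case False
    then have "j \<in> C \<longleftrightarrow> j \<in> B" if "j \<in> D" for j
      using assms(1)[OF i(1) that] i(2) by (cases "i \<in> A") (auto simp: of_bool_def split: if_splits)
    then show False using neq assms(3,4) by blast
  qed
qed

text \<open>With these vectors the cross product of two differences of vertices is a sum of powers
  \<open>5 ^ (i + d * j)\<close> with pairwise distinct exponents and coefficients in \<open>{-2..2}\<close>.\<close>

definition cube_axis :: "nat \<Rightarrow> nat \<Rightarrow> real^2" where
  "cube_axis d i = vector [5 ^ i, 5 ^ (d * i)]"

text \<open>If the cross product vanished, so would all its base 5 digits. These are the minors of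
  the two difference vectors in the cube, so two of the three vertices would coincide.\<close>

lemma cross_cube_proj_neq_0:
  assumes xyz: "x \<in> cube_vertices d" "y \<in> cube_vertices d" "z \<in> cube_vertices d"
    and "x \<noteq> y" "x \<noteq> z" "y \<noteq> z"
  defines "p \<equiv> cube_proj (cube_axis d)"
  shows "cross (p y - p x) (p z - p x) \<noteq> 0"
proof
  assume cross0: "cross (p y - p x) (p z - p x) = 0"
  define ind :: "nat \<Rightarrow> nat \<Rightarrow> int" where "ind u i = of_bool (i \<in> set_decode u)" for u i
  define a where "a i = ind y i - ind x i" for i
  define b where "b i = ind z i - ind x i" for i
  define c where "c = (\<lambda>(i, j). a i * b j - b i * a j)"
  let ?I = "{..<d} \<times> {..<d}"
  have p: "p u = (\<Sum>i<d. of_int (ind u i) *\<^sub>R cube_axis d i)" if "u \<in> cube_vertices d" for u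
  proof -
    have "p u = (\<Sum>i\<in>set_decode u. of_int (ind u i) *\<^sub>R cube_axis d i)"
      by (simp add: p_def cube_proj_def ind_def)
    also have "\<dots> = (\<Sum>i<d. of_int (ind u i) *\<^sub>R cube_axis d i)"
      using that by (intro sum.mono_neutral_left) (auto simp: ind_def mem_cube_vertices)
    finally show ?thesis .
  qed
  have py: "p y - p x = (\<Sum>i<d. of_int (a i) *\<^sub>R cube_axis d i)"
    and pz: "p z - p x = (\<Sum>i<d. of_int (b i) *\<^sub>R cube_axis d i)"
    by (simp_all add: p xyz a_def b_def algebra_simps flip: sum_subtractf)
  \<comment> \<open>The cross product is an integer, so the divisibility argument for digits applies
    to it.\<close>
  have "real_of_int (\<Sum>k\<in>?I. c k * 5 ^ (fst k + d * snd k)) = cross (p y - p x) (p z - p x)"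
    by (simp add: py pz cross_def cube_axis_def c_def sum_product sum.cartesian_product power_add
        case_prod_unfold algebra_simps flip: sum_subtractf)
  with cross0 have "(\<Sum>k\<in>?I. c k * 5 ^ (fst k + d * snd k)) = 0" by linarith
  moreover have "inj_on (\<lambda>k. fst k + d * snd k) ?I"
  proof (rule inj_onI, clarify)
    fix i j i' j' assume *: "i < d" "i' < d" "fst (i, j) + d * snd (i, j) = fst (i', j') + d * snd (i', j')"
    have "(i + d * j) mod d = (i' + d * j') mod d" "(i + d * j) div d = (i' + d * j') div d"
      using * by simp_all
    then show "i = i' \<and> j = j'" using * by simp
  qed
  moreover have "\<bar>c k\<bar> < 5" for k
    by (auto simp: c_def a_def b_def ind_def of_bool_def split: prod.split)
  ultimately have c0: "c k = 0" if "k \<in> ?I" for k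
    using that by (intro sum_power_eq_0_imp_digits_eq_0[of ?I "\<lambda>k. fst k + d * snd k" c 5]) auto
  have "set_decode x = set_decode y \<or> set_decode x = set_decode z \<or> set_decode y = set_decode z"
  proof (rule indicator_differences_dependent[of "{..<d}"])
    fix i j assume "i \<in> {..<d}" "j \<in> {..<d}"
    then show "(of_bool (i \<in> set_decode y) - of_bool (i \<in> set_decode x) :: int)
        * (of_bool (j \<in> set_decode z) - of_bool (j \<in> set_decode x))
     - (of_bool (i \<in> set_decode z) - of_bool (i \<in> set_decode x))
        * (of_bool (j \<in> set_decode y) - of_bool (j \<in> set_decode x)) = 0"
      using c0[of "(i, j)"] by (simp add: c_def a_def b_def ind_def)
  qed (use xyz in \<open>auto simp: mem_cube_vertices\<close>)
  then show False using assms(4-6) by (metis set_decode_inverse)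
qed

lemma not_collinear_cube_proj:
  assumes "T \<subseteq> cube_vertices d" "card T = 3"
  shows "\<not> collinear (cube_proj (cube_axis d) ` T)"
proof -
  obtain x y z where T: "T = {x, y, z}" "x \<noteq> y" "x \<noteq> z" "y \<noteq> z"
    using assms(2) by (auto simp: card_3_iff)
  then show ?thesis
    using collinear_3_imp_cross_eq_0 cross_cube_proj_neq_0[of x d y z] assms(1) by auto
qed

text \<open>Two vertices with the same image would be collinear with any third one, and for
  \<open>d\<close> at least 2 a third vertex exists.\<close>

lemma inj_on_cube_proj:
  assumes "d \<ge> 2"
  shows "inj_on (cube_proj (cube_axis d)) (cube_vertices d)"
proof (rule inj_onI, rule ccontr)
  let ?p = "cube_proj (cube_axis d)"
  fix x y assume xy: "x \<in> cube_vertices d" "y \<in> cube_vertices d" "?p x = ?p y" "x \<noteq> y"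
  have "(2::nat) ^ 2 \<le> 2 ^ d" using assms by (intro power_increasing) auto
  then have "\<not> cube_vertices d \<subseteq> {x, y}"
    using card_mono[of "{x, y}" "cube_vertices d"] xy(4) by (auto simp: card_cube_vertices)
  then obtain z where "z \<in> cube_vertices d" "z \<noteq> x" "z \<noteq> y" by blast
  then show False
    using not_collinear_cube_proj[of "{x, y, z}" d] xy by (simp add: collinear_2)
qed

section \<open>Flexibility of the induced subgraphs\<close>

text \<open>Otherwise any two of the sets would be nested and differ in one element, but the ends of a
  chain of three sets differ in at least two.\<close>

lemma ex_sets_not_adjacent:
  assumes "A \<noteq> B" "A \<noteq> C" "B \<noteq> C"
  shows "\<exists>X\<in>{A, B, C}. \<exists>Y\<in>{A, B, C}. \<exists>k. k \<in> X \<and> k \<notin> Y \<and> X - {k} \<noteq> Y"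
proof (rule ccontr)
  assume "\<not> ?thesis"
  then have H: "X - {k} = Y" if "X \<in> {A, B, C}" "Y \<in> {A, B, C}" "k \<in> X" "k \<notin> Y" for X Y k
    using that by blast
  have comparable: "X \<subset> Y \<or> Y \<subset> X" if "X \<in> {A, B, C}" "Y \<in> {A, B, C}" "X \<noteq> Y" for X Y
    using H[OF that(1,2)] H[OF that(2,1)] that(3) by blast
  have no_chain: False
    if XYZ: "X \<in> {A, B, C}" "Y \<in> {A, B, C}" "Z \<in> {A, B, C}" "X \<subset> Y" "Y \<subset> Z" for X Y Z
  proof -
    obtain k l where "k \<in> Y" "k \<notin> X" "l \<in> Z" "l \<notin> Y" using XYZ(4,5) by blast
    then show False using H[OF XYZ(3,1), of l] XYZ(4,5) by blast
  qed
  show False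
    using comparable[of A B] comparable[of A C] comparable[of B C] assms
      no_chain[of A B C] no_chain[of A C B] no_chain[of B A C]
      no_chain[of B C A] no_chain[of C A B] no_chain[of C B A]
    by auto
qed

text \<open>The rotated placements form a continuous curve of equivalent frameworks through the
  given one. Rigidity would make them congruent to it for all small angles of either sign,
  contradicting the nonzero cross product.\<close>

lemma not_rigid_cube_subgraph:
  assumes S: "S \<subseteq> cube_vertices d" "card S \<ge> 3"
  shows "\<not> rigid_framework S (induced_edges (cube_edges d) S)
           (restrict (cube_proj (cube_axis d)) S)"
proof
  let ?v = "cube_axis d" and ?E = "induced_edges (cube_edges d) S"
  let ?p = "cube_proj ?v"
  obtain T where T: "T \<subseteq> S" "card T = 3" using S(2) by (meson obtain_subset_with_card_n)
  then obtain x' y' z' where T': "T = {x', y', z'}" "x' \<noteq> y'" "x' \<noteq> z'" "y' \<noteq> z'"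
    by (auto simp: card_3_iff)
  then have "set_decode x' \<noteq> set_decode y'" "set_decode x' \<noteq> set_decode z'"
      "set_decode y' \<noteq> set_decode z'"
    by (metis set_decode_inverse)+
  from ex_sets_not_adjacent[OF this]
  have "\<exists>x\<in>T. \<exists>y\<in>T. \<exists>k. k \<in> set_decode x \<and> k \<notin> set_decode y \<and> set_decode x - {k} \<noteq> set_decode y"
    unfolding T'(1) by blast
  then obtain x y k where xy: "x \<in> S" "y \<in> S" "k \<in> set_decode x" "k \<notin> set_decode y"
    "set_decode x - {k} \<noteq> set_decode y"
    using T(1) by blast
  \<comment> \<open>The neighbour of \<open>x\<close> in direction \<open>k\<close>, which need not
    lie in \<open>S\<close>. It differs from \<open>y\<close> by the choice of \<open>k\<close>, so
    \<open>x\<close>, \<open>y\<close>, \<open>z\<close> are not collinear in the drawing; this is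
    what makes \<open>cross (?v k) w\<close> nonzero.\<close>
  define z where "z = set_encode (set_decode x - {k})"
  have dz: "set_decode z = set_decode x - {k}" by (simp add: z_def set_encode_inverse)
  define w where "w = ?p z - ?p y"
  have px: "?p x = ?v k + ?p z"
    using xy(3) by (simp add: cube_proj_def dz sum.remove)
  have "cross (?v k) w \<noteq> 0"
  proof -
    have "x \<in> cube_vertices d" "y \<in> cube_vertices d" using S(1) xy(1,2) by auto
    moreover from this have "z \<in> cube_vertices d" by (auto simp: mem_cube_vertices dz)
    moreover have "z \<noteq> x" "z \<noteq> y" "x \<noteq> y" using xy(3-5) dz by auto
    ultimately have "cross (?p x - ?p z) (?p y - ?p z) \<noteq> 0"
      by (intro cross_cube_proj_neq_0)
    then show ?thesis by (simp add: px w_def cross_def algebra_simps)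
  qed
  define q where "q t = cube_proj (?v(k := rot t (?v k)))" for t
  have q_diff: "q t x - q t y = rot t (?v k) + w" for t
  proof -
    have "q t y = ?p y" using xy(4) by (auto simp: q_def cube_proj_def intro!: sum.cong)
    moreover have "q t x = rot t (?v k) + ?p z"
      using xy(3) by (auto simp: q_def cube_proj_def dz sum.remove intro!: sum.cong)
    ultimately show ?thesis by (simp add: w_def)
  qed
  have q0: "q 0 = ?p" by (simp add: q_def)
  have equiv: "equivalent_frameworks ?E (restrict ?p S) (restrict (q t) S)" for t
    unfolding equivalent_frameworks_def
  proof (intro allI impI)
    \<comment> \<open>The endpoints of an edge differ by a single axis vector, and its length is the
      same for every angle \<open>t\<close>.\<close>
    have *: "norm (?p b - ?p a) = norm (q t b - q t a)"
      if "set_decode b = insert i (set_decode a)" "i \<notin> set_decode a" for a b i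
      using that by (simp add: cube_proj_def q_def)
    fix i j assume "{i, j} \<in> ?E"
    then have ij: "i \<in> S" "j \<in> S" "{i, j} \<in> cube_edges d" by (auto simp: induced_edges_def)
    then obtain l A where A: "A \<subseteq> {..<d} - {l}" "{i, j} = {set_encode A, set_encode (insert l A)}"
      by (auto simp: cube_edges_def)
    then have "finite A" by (auto intro: finite_subset_lessThan)
    then have "set_decode (set_encode (insert l A)) = insert l (set_decode (set_encode A))"
      "l \<notin> set_decode (set_encode A)" using A(1) by (auto simp: set_encode_inverse)
    from *[OF this] A(2) ij
    show "norm (restrict ?p S i - restrict ?p S j) = norm (restrict (q t) S i - restrict (q t) S j)"
      by (auto simp: doubleton_eq_iff norm_minus_commute)
  qed
  have cont: "continuous_map euclidean (product_topology (\<lambda>_. euclidean) S) (\<lambda>t. restrict (q t) S)"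
  proof -
    have "continuous_on UNIV (\<lambda>t. (?v(k := rot t (?v k))) i)" for i
      by (cases "i = k") (simp_all add: continuous_on_rot)
    then have "continuous_on UNIV (\<lambda>t. q t u)" for u
      unfolding q_def cube_proj_def by (intro continuous_on_sum)
    then show ?thesis by (auto simp: continuous_map_componentwise)
  qed
  assume "rigid_framework S ?E (restrict ?p S)"
  then obtain B where B: "openin (product_topology (\<lambda>_. euclidean) S) B" "restrict ?p S \<in> B"
    and cong: "\<And>p'. p' \<in> B \<Longrightarrow> equivalent_frameworks ?E (restrict ?p S) p'
      \<Longrightarrow> congruent_frameworks S (restrict ?p S) p'"
    by (auto simp: rigid_framework_def)
  have "open {t. restrict (q t) S \<in> B}"
    using openin_continuous_map_preimage[OF cont B(1)] by simp
  moreover have "0 \<in> {t. restrict (q t) S \<in> B}" using B(2) by (simp add: q0)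
  ultimately obtain r where "r > 0" "\<And>t. dist t 0 < r \<Longrightarrow> t \<in> {t. restrict (q t) S \<in> B}"
    unfolding open_dist by blast
  then have r: "r > 0" "\<And>t. \<bar>t\<bar> < r \<Longrightarrow> restrict (q t) S \<in> B" by simp_all
  have norm_eq: "norm (rot t (?v k) + w) = norm (?v k + w)" if "\<bar>t\<bar> < r" for t
  proof -
    have "norm (?p x - ?p y) = norm (q t x - q t y)"
      using cong[OF r(2)[OF that] equiv] xy(1,2) by (simp add: congruent_frameworks_def)
    then show ?thesis using q_diff[of 0] by (simp add: q_diff q0)
  qed
  \<comment> \<open>The bound \<open>r / 2\<close> keeps both \<open>t\<close> and
    \<open>- t\<close> in the range where distances are preserved; the bound 1 keeps
    \<open>t\<close> below \<open>pi\<close>, so that \<open>sin t\<close> is nonzero.\<close>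
  define t where "t = min 1 (r / 2)"
  have t: "0 < t" "t < r" "t < pi" using r(1) pi_gt3 by (auto simp: t_def min_def)
  then have "sin t \<noteq> 0" using sin_gt_zero[of t] by simp
  with norm_eq[of t] norm_eq[of "- t"] t have "cross (?v k) w = 0"
    by (intro norm_rot_add_const_imp_cross_eq_0[of t]) auto
  with \<open>cross (?v k) w \<noteq> 0\<close> show False by simp
qed

theorem theorem1p2:
  fixes d :: nat
  assumes "d \<ge> 2"
  shows "\<exists>(V :: nat set) (E :: nat set set) (p :: nat \<Rightarrow> real^2).
           simple_graph V E \<and>
           card V = 2 ^ d \<and>
           real (card E) = 1 / 2 * real (card V) * log 2 (real (card V)) \<and>
           inj_on p V \<and>
           (\<forall>T\<subseteq>V. card T = 3 \<longrightarrow> \<not> collinear (p ` T)) \<and>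
           (\<forall>S\<subseteq>V. card S \<ge> 3 \<longrightarrow>
              \<not> rigid_framework S (induced_edges E S) (restrict p S))"
proof -
  \<comment> \<open>The case split on \<open>d\<close> removes the truncated subtraction in
    \<open>2 ^ (d - 1)\<close>.\<close>
  have "real (card (cube_edges d)) =
      1 / 2 * real (card (cube_vertices d)) * log 2 (real (card (cube_vertices d)))"
    using assms by (cases d)
      (simp_all add: card_cube_edges card_cube_vertices log_mult log_nat_power algebra_simps)
  then show ?thesis
    using simple_graph_cube card_cube_vertices inj_on_cube_proj[OF assms]
      not_collinear_cube_proj not_rigid_cube_subgraph by blast
qed

end
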